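(* Let $n,s \in \mathbb{N}$ with $s \geqslant 2$. Then $$m(n,2s+1,s,1) = \left\lceil \left(1 - \binom{2s+1}{s}^{-1}\right) n \right\rceil.$$
   Context: An $r$-colouring of the complete graph $K_n$ ($n \geqslant 2$) is any function $f: E(K_n) \to [r] = \{1,\dots,r\}$. For a subgraph $H \subseteq K_n$, $c_f(H) = |f(E(H))|$ is the number of distinct colours on edges of $H$. A graph on at least $k+1$ vertices is $k$-connected if deleting any at most $k-1$ vertices leaves a connected graph. $M(f,n,r,s,k)$ is the maximum number of vertices of a $k$-connected subgraph $H \subseteq K_n$ with $c_f(H) \leqslant s$ (taken to be $0$ if no such subgraph exists), and $m(n,r,s,k) = \min_f M(f,n,r,s,k)$, the minimum over all $r$-colourings $f$ of $E(K_n)$. *)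

theory Defs
  imports Complex_Main "HOL-Library.FuncSet"
begin

text \<open>
  A finite simple graph is given by a vertex set \<open>V\<close> and a set \<open>E\<close> of edges, each edge being
  a two-element subset of \<open>V\<close>.  The complete graph on \<open>n\<close> vertices lives on \<open>{1..n}\<close>.
\<close>

definition all_edges :: "nat set \<Rightarrow> nat set set" where
  "all_edges V = {e. e \<subseteq> V \<and> card e = 2}"

definition subgraph_complete :: "nat \<Rightarrow> nat set \<Rightarrow> nat set set \<Rightarrow> bool" where
  "subgraph_complete n V E \<longleftrightarrow> V \<subseteq> {1..n} \<and> E \<subseteq> all_edges V"

definition connected_graph :: "nat set \<Rightarrow> nat set set \<Rightarrow> bool" where
  "connected_graph V E \<longleftrightarrow>
     V \<noteq> {} \<and> (\<forall>u\<in>V. \<forall>v\<in>V. (u, v) \<in> {(x, y). {x, y} \<in> E}\<^sup>*)"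

text \<open>
  Here \<open>card S < k\<close> says \<open>card S \<le> k - 1\<close> without truncated subtraction.
\<close>

definition k_connected :: "nat \<Rightarrow> nat set \<Rightarrow> nat set set \<Rightarrow> bool" where
  "k_connected k V E \<longleftrightarrow>
     k + 1 \<le> card V \<and>
     (\<forall>S. S \<subseteq> V \<and> card S < k \<longrightarrow> connected_graph (V - S) {e \<in> E. e \<inter> S = {}})"

text \<open>
  Colourings are extensional functions (\<open>undefined\<close> off the edge set), so they correspond
  one-to-one to functions on the edge set and there are only finitely many of them.
\<close>

definition colourings :: "nat \<Rightarrow> nat \<Rightarrow> (nat set \<Rightarrow> nat) set" where
  "colourings n r = all_edges {1..n} \<rightarrow>\<^sub>E {1..r}"

definition num_colours :: "(nat set \<Rightarrow> nat) \<Rightarrow> nat set set \<Rightarrow> nat" where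
  "num_colours f E = card (f ` E)"

text \<open>
  The number of colours \<open>r\<close> enters only through the colouring \<open>f\<close>, hence is not a parameter of
  \<open>max_order\<close>.  Inserting \<open>0\<close> gives the value \<open>0\<close> when there is no such subgraph, and
  otherwise does not affect the maximum.
\<close>

definition max_order :: "(nat set \<Rightarrow> nat) \<Rightarrow> nat \<Rightarrow> nat \<Rightarrow> nat \<Rightarrow> nat" where
  "max_order f n s k =
     Max (insert 0 {card V | V E. subgraph_complete n V E \<and> k_connected k V E \<and>
                                  num_colours f E \<le> s})"

definition min_max_order :: "nat \<Rightarrow> nat \<Rightarrow> nat \<Rightarrow> nat \<Rightarrow> nat" where
  "min_max_order n r s k = Min ((\<lambda>f. max_order f n s k) ` colourings n r)"

end

theory Submission
  imports Defs
begin

text \<open>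
  Write \<open>N\<close> for \<open>2 * s + 1 choose s\<close>; both sides equal \<open>n - n div N\<close>.  For the upper bound, split
  the vertices evenly into parts indexed by the \<open>s\<close>-sets of colours and give an edge between
  the parts \<open>A\<close> and \<open>B\<close> a colour outside \<open>A \<union> B\<close>: a connected graph using only colours of \<open>A\<close>
  misses the part \<open>A\<close>.

  For the lower bound, suppose that no \<open>s\<close>-set of colours gives a connected graph.  The edges
  across a cut of the colours \<open>A\<close> have only the \<open>s + 1 \<ge> 3\<close> colours outside \<open>A\<close>, and omitting any
  one of these colours still leaves a disconnected graph.  This forces one side \<open>X\<close> of the
  cut to be a hub: for every colour \<open>c\<close> outside \<open>A\<close> some vertex of the other side is joined to \<open>X\<close> in
  colour \<open>c\<close> only.  If \<open>A\<close> and \<open>D\<close> are disjoint and \<open>c\<close> is the remaining colour, then any hubs of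
  \<open>A\<close> and \<open>D\<close> are disjoint and all edges between them have colour \<open>c\<close>.  It follows that hubs of
  any two distinct \<open>s\<close>-sets are disjoint, so some \<open>s\<close>-set \<open>A\<close> has only hubs of size at
  most \<open>n div N\<close>, and the complement of a largest hub of \<open>A\<close> is connected in the colours of \<open>A\<close>.
\<close>

section \<open>Cuts and stars in a coloured complete graph\<close>

locale coloured_complete_graph =
  fixes V :: "'v set" and C :: "'c set" and g :: "'v \<Rightarrow> 'v \<Rightarrow> 'c" and s :: nat
  assumes finite_V: "finite V"
    and sym: "g x y = g y x"
    and colour: "x \<in> V \<Longrightarrow> y \<in> V \<Longrightarrow> x \<noteq> y \<Longrightarrow> g x y \<in> C"
    and card_C: "card C = 2 * s + 1"
    and s_ge_2: "2 \<le> s"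
begin

text \<open>The set \<open>W\<close> is a parameter because cuts of \<open>V - X\<close>, for a hub
  \<open>X\<close>, are needed besides cuts of \<open>V\<close>.\<close>

definition is_cut :: "'v set \<Rightarrow> 'c set \<Rightarrow> 'v set \<Rightarrow> bool" where
  "is_cut W A X \<longleftrightarrow> X \<noteq> {} \<and> X \<subset> W \<and> (\<forall>x\<in>X. \<forall>y\<in>W - X. g x y \<notin> A)"

definition hub :: "'c set \<Rightarrow> 'v set \<Rightarrow> bool" where
  "hub A X \<longleftrightarrow> is_cut V A X \<and> (\<forall>c\<in>C - A. \<exists>y\<in>V - X. \<forall>x\<in>X. g x y = c)"

definition small_sets :: "'c set set" where
  "small_sets = {A. A \<subseteq> C \<and> card A = s}"

lemma finite_C: "finite C"
  using card_C by (intro card_ge_0_finite) simp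

lemma is_cut_complement:
  assumes "is_cut W A X"
  shows "is_cut W A (W - X)"
proof -
  have "g x y \<notin> A" if "x \<in> W - X" "y \<in> X" for x y
    using assms that sym[of x y] unfolding is_cut_def by auto
  then show ?thesis using assms unfolding is_cut_def by auto
qed

lemma same_side:
  assumes "is_cut W A X" "u \<in> W" "v \<in> W" "g u v \<in> A"
  shows "u \<in> X \<longleftrightarrow> v \<in> X"
proof -
  have "g v u \<in> A" using assms(4) sym[of u v] by simp
  then show ?thesis using assms unfolding is_cut_def by blast
qed

lemma card_complement:
  assumes "A \<in> small_sets"
  shows "card (C - A) = s + 1"
  using assms card_C finite_C unfolding small_sets_def
  by (auto simp: card_Diff_subset finite_subset)

lemma complement_in_small_sets:
  assumes "A \<in> small_sets" "c \<in> C - A"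
  shows "C - A - {c} \<in> small_sets"
  using assms card_complement[OF assms(1)] finite_C unfolding small_sets_def
  by (auto simp: card_Diff_singleton)

lemma obtain_two_other_colours:
  assumes "A \<in> small_sets"
  obtains c' c'' where "c' \<in> C - A" "c'' \<in> C - A" "c' \<noteq> c" "c'' \<noteq> c" "c' \<noteq> c''"
proof -
  have "2 \<le> card (C - A - {c})"
    using card_complement[OF assms] s_ge_2 finite_C by (simp add: card_Diff_singleton_if)
  then obtain T where "T \<subseteq> C - A - {c}" "card T = 2"
    by (meson obtain_subset_with_card_n)
  then show thesis using that by (auto simp: card_2_iff)
qed

text \<open>An edge across both cuts has no colour in \<open>A\<close> or in
  \<open>C - A - {c}\<close>, which leaves only \<open>c\<close>.\<close>

lemma double_cut_colour:
  assumes "is_cut V A X" "is_cut V (C - A - {c}) P"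
    and "x \<in> X" "y \<in> V - X" "x \<in> P \<longleftrightarrow> y \<notin> P"
  shows "g x y = c"
proof -
  have V: "x \<in> V" "y \<in> V" "x \<noteq> y" using assms unfolding is_cut_def by auto
  have "g x y \<notin> A" using assms unfolding is_cut_def by auto
  moreover have "g x y \<notin> C - A - {c}"
    using same_side[OF assms(2) V(1,2)] assms(5) by blast
  ultimately show ?thesis using colour[OF V] by auto
qed

lemma star_on_some_side:
  assumes A: "A \<in> small_sets" and c: "c \<in> C - A" and X: "is_cut V A X"
    and cuts: "\<And>B. B \<in> small_sets \<Longrightarrow> \<exists>P. is_cut V B P"
  shows "(\<exists>y\<in>V - X. \<forall>x\<in>X. g x y = c) \<or> (\<exists>x\<in>X. \<forall>y\<in>V - X. g x y = c)"
proof (rule ccontr)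
  assume no_star: "\<not> ?thesis"
  obtain P where P: "is_cut V (C - A - {c}) P"
    using cuts complement_in_small_sets[OF A c] by blast
  note cP = double_cut_colour[OF X P]
  have sub: "X \<subseteq> V" "P \<subseteq> V" "P \<noteq> {}" "P \<noteq> V" using X P unfolding is_cut_def by auto
  \<comment> \<open>If one of the four cells given by \<open>X\<close> and \<open>P\<close> were
    empty, a vertex across \<open>X\<close> from it, on the same side of \<open>P\<close>, would be
    the centre of a star of colour \<open>c\<close>.\<close>
  have "X \<inter> P \<noteq> {}"
  proof
    assume e: "X \<inter> P = {}"
    obtain y where "y \<in> P" using sub by auto
    then show False using no_star cP e sub by blast
  qed
  then obtain x1 where x1: "x1 \<in> X" "x1 \<in> P" by blast
  have "X - P \<noteq> {}"
  proof
    assume e: "X - P = {}"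
    obtain y where "y \<in> V - P" using sub by auto
    then show False using no_star cP e sub by blast
  qed
  then obtain x2 where x2: "x2 \<in> X" "x2 \<notin> P" by blast
  have "(V - X) \<inter> P \<noteq> {}" using no_star cP x1 by blast
  then obtain y1 where y1: "y1 \<in> V - X" "y1 \<in> P" by blast
  have "(V - X) - P \<noteq> {}" using no_star cP x2 by blast
  then obtain y2 where y2: "y2 \<in> V - X" "y2 \<notin> P" by blast
  txt \<open>A cut \<open>Q\<close> omitting another colour \<open>d\<close> cannot separate the ends of the edges across both
    \<open>X\<close> and \<open>P\<close>, so it is \<open>(X \<inter> P) \<union> ((V - X) - P)\<close> up to complement, and \<open>d\<close> is the colour of
    \<open>x1 y1\<close>.  Two choices of \<open>d\<close> contradict each other.\<close>
  have forced: "g x1 y1 = d" if d: "d \<in> C - A" "d \<noteq> c" for d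
  proof -
    obtain Q where Q: "is_cut V (C - A - {d}) Q"
      using cuts complement_in_small_sets[OF A d(1)] by blast
    note cQ = double_cut_colour[OF X Q]
    have same: "x \<in> Q \<longleftrightarrow> y \<in> Q" if "x \<in> X" "y \<in> V - X" "x \<in> P \<longleftrightarrow> y \<notin> P" for x y
      using cP[OF that] cQ[of x y] that d by auto
    have "x1 \<in> Q \<longleftrightarrow> y1 \<notin> Q"
    proof (rule ccontr)
      assume "\<not> ?thesis"
      then have "z \<in> Q \<longleftrightarrow> x1 \<in> Q" if "z \<in> V" for z
        using same x1 x2 y1 y2 that by (metis DiffI)
      then show False using Q x1 unfolding is_cut_def by blast
    qed
    then show ?thesis using cQ x1 y1 by blast
  qed
  obtain c' c'' where "c' \<in> C - A" "c'' \<in> C - A" "c' \<noteq> c" "c'' \<noteq> c" "c' \<noteq> c''"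
    using obtain_two_other_colours[OF A] .
  then show False using forced by metis
qed

section \<open>Hubs and their disjointness\<close>

lemma hub_on_some_side:
  assumes A: "A \<in> small_sets" and X: "is_cut V A X"
    and cuts: "\<And>B. B \<in> small_sets \<Longrightarrow> \<exists>P. is_cut V B P"
  shows "hub A X \<or> hub A (V - X)"
proof (rule ccontr)
  assume not: "\<not> ?thesis"
  have XV: "X \<subseteq> V" using X unfolding is_cut_def by auto
  let ?out = "\<lambda>c. \<exists>y\<in>V - X. \<forall>x\<in>X. g x y = c"
  let ?in = "\<lambda>c. \<exists>x\<in>X. \<forall>y\<in>V - X. g x y = c"
  obtain c where c: "c \<in> C - A" "\<not> ?out c" using not X unfolding hub_def by blast
  obtain d where d: "d \<in> C - A" "\<not> ?in d"
    using not is_cut_complement[OF X] XV sym unfolding hub_def by (metis double_diff order_refl)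
  have "?in c" "?out d" using star_on_some_side[OF A _ X cuts] c d by blast+
  \<comment> \<open>The two stars have their centres on opposite sides of the cut, so they share the
    edge between the centres.\<close>
  then have "c = d" by fast
  then show False using c d star_on_some_side[OF A _ X cuts] by blast
qed

lemma hub_disjoint_colour:
  assumes A: "A \<in> small_sets" and c: "c \<in> C - A"
    and X: "hub A X" and W: "hub (C - A - {c}) W" and x: "x \<in> X" and w: "w \<in> W"
  shows "w \<notin> X \<and> g w x = c"
proof -
  let ?B = "C - A - {c}"
  have cX: "is_cut V A X" and cW: "is_cut V ?B W" using X W unfolding hub_def by auto
  have sub: "X \<subseteq> V" "W \<subseteq> V" using cX cW unfolding is_cut_def by auto
  have noncross: "u \<in> W \<longleftrightarrow> v \<in> W" if "u \<in> V" "v \<in> V" "g u v \<in> ?B" for u v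
    using same_side[OF cW that] .
  obtain d where d: "d \<in> C - A" "d \<noteq> c" using obtain_two_other_colours[OF A] by metis
  \<comment> \<open>Edges of colour \<open>d \<in> ?B\<close> do not cross the cut \<open>W\<close>,
    so \<open>y\<close> holds all of \<open>X\<close> on one side of it.\<close>
  obtain y where y: "y \<in> V - X" "\<forall>x\<in>X. g x y = d" using X d unfolding hub_def by blast
  have Xside: "u \<in> W \<longleftrightarrow> x \<in> W" if "u \<in> X" for u
    using noncross[of u y] noncross[of x y] y d x sub that by auto
  have other: "v \<in> W \<longleftrightarrow> x \<in> W" if v: "v \<in> V - X" "u \<in> X" "g u v \<noteq> c" for u v
  proof -
    have "u \<in> V" "v \<in> V" "u \<noteq> v" using v sub by auto
    then have "g u v \<in> C" by (rule colour)
    then have "g u v \<in> ?B" using cX v unfolding is_cut_def by auto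
    then show ?thesis using noncross[of u v] v sub Xside by blast
  qed
  \<comment> \<open>If \<open>X\<close> lay inside \<open>W\<close>, a star of colour
    \<open>e \<in> A\<close> from \<open>W\<close> to some \<open>z\<close> outside would contain
    the edge \<open>x z\<close>, which crosses both cuts and therefore has colour
    \<open>c\<close>.\<close>
  have "x \<notin> W"
  proof
    assume xW: "x \<in> W"
    obtain e where e: "e \<in> C - ?B" "e \<noteq> c"
    proof -
      have "A \<noteq> {}" using A s_ge_2 unfolding small_sets_def by auto
      then obtain e where "e \<in> A" by blast
      then show thesis using that A c unfolding small_sets_def by blast
    qed
    obtain z where z: "z \<in> V - W" "\<forall>u\<in>W. g u z = e" using W e unfolding hub_def by blast
    have "z \<in> V - X" using z Xside xW by auto
    then have "g x z = c" using other[of z x] x z xW by auto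
    then show False using z xW e by auto
  qed
  then show ?thesis using other[of w x] Xside[of w] w x sub sym[of w x] by auto
qed

lemma maximal_hub:
  assumes A: "A \<in> small_sets"
    and cuts: "\<And>B. B \<in> small_sets \<Longrightarrow> \<exists>P. is_cut V B P"
  shows "\<exists>X. hub A X \<and> (\<forall>U. \<not> is_cut (V - X) A U)"
proof -
  have hubs: "\<exists>X. hub B X" if "B \<in> small_sets" for B
    using cuts hub_on_some_side that by metis
  have hubV: "X \<subseteq> V" if "hub B X" for B X using that unfolding hub_def is_cut_def by auto
  define X where "X = (ARG_MAX card X. hub A X)"
  have X: "hub A X" and max: "\<And>Y. hub A Y \<Longrightarrow> card Y \<le> card X"
  proof -
    obtain X0 where "hub A X0" using hubs A by blast
    moreover have "\<forall>Y. hub A Y \<longrightarrow> card Y < Suc (card V)"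
      using finite_V hubV by (auto simp: card_mono less_Suc_eq_le)
    ultimately have "hub A X \<and> (\<forall>Y. hub A Y \<longrightarrow> card Y \<le> card X)"
      unfolding X_def by (rule arg_max_nat_lemma)
    then show "hub A X" "\<And>Y. hub A Y \<Longrightarrow> card Y \<le> card X" by auto
  qed
  have cX: "is_cut V A X" using X unfolding hub_def by auto
  \<comment> \<open>Enlarging \<open>X\<close> by \<open>U\<close> gives another cut of
    \<open>V\<close>; by maximality of \<open>card X\<close>, only its opposite side can be a
    hub.\<close>
  have rest: "hub A (V - X - U)" if U: "is_cut (V - X) A U" for U
  proof -
    have "is_cut V A (X \<union> U)" using cX U unfolding is_cut_def by blast
    moreover have "\<not> hub A (X \<union> U)"
    proof
      assume h: "hub A (X \<union> U)"
      have "X \<subset> X \<union> U" using U unfolding is_cut_def by auto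
      then have "card X < card (X \<union> U)"
        using hubV[OF h] finite_V by (meson psubset_card_mono finite_subset)
      then show False using max[OF h] by simp
    qed
    ultimately have "hub A (V - (X \<union> U))" using hub_on_some_side[OF A _ cuts] by blast
    then show ?thesis by (simp add: Diff_eq Int_assoc)
  qed
  \<comment> \<open>The sets \<open>X\<close>, \<open>U\<close> and \<open>V - X - U\<close> would
    be hubs of \<open>A\<close> covering \<open>V\<close>, leaving no room for a hub of the disjoint
    set \<open>?D\<close>.\<close>
  have False if U: "is_cut (V - X) A U" for U
  proof -
    have h1: "hub A (V - X - (V - X - U))" using rest is_cut_complement[OF U] .
    have "U \<subseteq> V - X" using U unfolding is_cut_def by auto
    then have h1: "hub A U" using h1 by (simp add: double_diff)
    have h2: "hub A (V - X - U)" using rest U by blast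
    obtain c where c: "c \<in> C - A" using obtain_two_other_colours[OF A] by metis
    let ?D = "C - A - {c}"
    have D: "?D \<in> small_sets" using complement_in_small_sets A c by blast
    obtain Y where Y: "hub ?D Y" using hubs D by blast
    then obtain y where y: "y \<in> Y" "y \<in> V" using hubV unfolding hub_def is_cut_def by blast
    have "y \<notin> T" if "hub A T" for T
      using hub_disjoint_colour[OF A c that Y _ y(1)] that unfolding hub_def is_cut_def by blast
    then show False using h1 h2 X y by blast
  qed
  then show ?thesis using X by blast
qed

lemma hubs_disjoint:
  assumes X: "\<And>A. A \<in> small_sets \<Longrightarrow> hub A (X A)"
    and A: "A \<in> small_sets" and B: "B \<in> small_sets" and "A \<noteq> B"
  shows "X A \<inter> X B = {}"
proof (rule ccontr)
  assume meet: "X A \<inter> X B \<noteq> {}"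
  txt \<open>A common vertex of \<open>X A\<close> and \<open>X B\<close> is joined to all of \<open>X (C - A - {c})\<close> in the colour
    \<open>c \<in> B\<close>, and no such edge leaves \<open>X B\<close>.\<close>
  have into: "X (C - A - {c}) \<subseteq> X B"
    if A: "A \<in> small_sets" and B: "B \<in> small_sets" and meet: "X A \<inter> X B \<noteq> {}"
      and c: "c \<in> B - A" for A B c
  proof
    fix u assume u: "u \<in> X (C - A - {c})"
    have cA: "c \<in> C - A" using B c unfolding small_sets_def by auto
    let ?D = "C - A - {c}"
    have D: "?D \<in> small_sets" using complement_in_small_sets A cA by blast
    obtain v where v: "v \<in> X A" "v \<in> X B" using meet by blast
    have "g u v = c" using hub_disjoint_colour[OF A cA X[OF A] X[OF D] v(1) u] by blast
    moreover have "u \<in> V" using u X[OF D] unfolding hub_def is_cut_def by auto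
    ultimately show "u \<in> X B"
      using X[OF B] v c sym[of u v] unfolding hub_def is_cut_def by auto
  qed
  have nonempty: "X A \<noteq> {}" if "A \<in> small_sets" for A
    using X[OF that] unfolding hub_def is_cut_def by auto
  \<comment> \<open>Apply \<open>into\<close> twice: for fixed \<open>c\<close>, passing from
    \<open>A\<close> to \<open>C - A - {c}\<close> is an involution.\<close>
  have sub: "X A \<subseteq> X B"
    if A: "A \<in> small_sets" and B: "B \<in> small_sets" and meet: "X A \<inter> X B \<noteq> {}"
      and c: "c \<in> B - A" for A B c
  proof -
    have cA: "c \<in> C - A" using B c unfolding small_sets_def by auto
    let ?D = "C - A - {c}"
    have D: "?D \<in> small_sets" using complement_in_small_sets A cA by blast
    have "X ?D \<inter> X B \<noteq> {}" using into[OF A B meet c] nonempty[OF D] by blast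
    then have "X (C - ?D - {c}) \<subseteq> X B" using into[OF D B] c by blast
    moreover have "C - ?D - {c} = A" using A cA unfolding small_sets_def by blast
    ultimately show ?thesis by simp
  qed
  have fin: "finite A" "finite B" "card A = card B"
    using A B finite_C finite_subset unfolding small_sets_def by auto
  then have "\<not> A \<subseteq> B" "\<not> B \<subseteq> A" using \<open>A \<noteq> B\<close> by (metis card_subset_eq)+
  then obtain c d where c: "c \<in> B - A" and d: "d \<in> A - B" by blast
  have eq: "X A = X B" using sub[OF A B meet c] sub[OF B A _ d] meet by blast
  have cA: "c \<in> C - A" using B c unfolding small_sets_def by auto
  have D: "C - A - {c} \<in> small_sets" using complement_in_small_sets A cA by blast
  \<comment> \<open>The hub of \<open>C - A - {c}\<close> would lie in \<open>X A\<close>, although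
    hubs of disjoint \<open>s\<close>-sets are disjoint.\<close>
  have "X (C - A - {c}) \<subseteq> X A" using into[OF A B meet c] eq by simp
  then show False
    using hub_disjoint_colour[OF A cA X[OF A] X[OF D]] nonempty[OF D] by blast
qed

section \<open>Lower bound: a small hub by averaging\<close>

lemma large_uncut_set:
  "\<exists>A\<in>small_sets. \<exists>W\<subseteq>V. card V - card V div (2 * s + 1 choose s) \<le> card W \<and>
     (\<forall>U. \<not> is_cut W A U)"
proof (cases "\<forall>A\<in>small_sets. \<exists>P. is_cut V A P")
  case False
  then show ?thesis by (metis diff_le_self order_refl)
next
  case True
  then have "\<forall>A\<in>small_sets. \<exists>X. hub A X \<and> (\<forall>U. \<not> is_cut (V - X) A U)"
    using maximal_hub by blast
  then obtain X where X: "\<And>A. A \<in> small_sets \<Longrightarrow> hub A (X A)"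
    and uncut: "\<And>A U. A \<in> small_sets \<Longrightarrow> \<not> is_cut (V - X A) A U" by metis
  let ?N = "2 * s + 1 choose s"
  have XV: "X A \<subseteq> V" if "A \<in> small_sets" for A
    using X[OF that] unfolding hub_def is_cut_def by auto
  have fin: "finite small_sets" using finite_C unfolding small_sets_def by simp
  have N: "card small_sets = ?N"
    unfolding small_sets_def using n_subsets[OF finite_C] card_C by simp
  have "(\<Sum>A\<in>small_sets. card (X A)) = card (\<Union>A\<in>small_sets. X A)"
    using fin XV finite_V hubs_disjoint[OF X]
    by (intro card_UN_disjoint[symmetric]) (auto intro: finite_subset)
  also have "\<dots> \<le> card V" using XV finite_V by (intro card_mono) auto
  finally have sum: "(\<Sum>A\<in>small_sets. card (X A)) \<le> card V" .
  have "\<exists>A\<in>small_sets. card (X A) \<le> card V div ?N"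
  proof (rule ccontr)
    assume "\<not> ?thesis"
    then have "of_nat (card small_sets) * Suc (card V div ?N) \<le> (\<Sum>A\<in>small_sets. card (X A))"
      by (intro sum_bounded_below) auto
    then have "?N * Suc (card V div ?N) \<le> card V" using sum N by simp
    moreover have "card V < ?N * Suc (card V div ?N)"
      using dividend_less_times_div[of ?N "card V"] by simp
    ultimately show False by simp
  qed
  then obtain A where A: "A \<in> small_sets" "card (X A) \<le> card V div ?N" by blast
  then have "card V - card V div ?N \<le> card (V - X A)"
    using card_Diff_subset[of "X A" V] XV[OF A(1)] finite_V finite_subset[of "X A" V] by simp
  then show ?thesis using A uncut by blast
qed

end

section \<open>Lower bound: the connected subgraph\<close>

lemma connected_graph_if_uncut:
  assumes "W \<noteq> {}"
    and uncut: "\<And>U. U \<noteq> {} \<Longrightarrow> U \<subset> W \<Longrightarrow> \<exists>x\<in>U. \<exists>y\<in>W - U. {x, y} \<in> E"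
  shows "connected_graph W E"
  unfolding connected_graph_def
proof (intro conjI ballI)
  let ?R = "{(x, y). {x, y} \<in> E}\<^sup>*"
  fix u v assume u: "u \<in> W" and v: "v \<in> W"
  show "(u, v) \<in> ?R"
  proof (rule ccontr)
    assume "(u, v) \<notin> ?R"
    \<comment> \<open>The vertices of \<open>W\<close> reachable from \<open>u\<close> form a
      nonempty proper subset, so some edge would leave it.\<close>
    then have "\<exists>x\<in>{w\<in>W. (u, w) \<in> ?R}. \<exists>y\<in>W - {w\<in>W. (u, w) \<in> ?R}. {x, y} \<in> E"
      using u v by (intro uncut) auto
    then obtain x y where "(u, x) \<in> ?R" "{x, y} \<in> E" "y \<in> W" "(u, y) \<notin> ?R" by auto
    then show False by (auto dest: rtrancl_into_rtrancl)
  qed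
qed (fact assms(1))

lemma k_connected_1:
  assumes "finite V"
  shows "k_connected 1 V E \<longleftrightarrow> 2 \<le> card V \<and> connected_graph V E"
proof -
  \<comment> \<open>Finiteness matters here: an infinite \<open>S\<close> has
    \<open>card S = 0\<close>.\<close>
  have "S \<subseteq> V \<and> card S < 1 \<longleftrightarrow> S = {}" for S
    using assms finite_subset[of S V] by auto
  then show ?thesis unfolding k_connected_def by (auto simp: numeral_2_eq_2)
qed

lemma finite_subgraph_orders:
  "finite {card V | V E. subgraph_complete n V E \<and> k_connected k V E \<and> num_colours f E \<le> s}"
proof (rule finite_subset)
  show "{card V | V E. subgraph_complete n V E \<and> k_connected k V E \<and> num_colours f E \<le> s}
      \<subseteq> card ` Pow {1..n}"
    unfolding subgraph_complete_def by auto
qed simp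

lemma max_order_lower:
  assumes n: "2 \<le> n" and s: "2 \<le> s" and f: "f \<in> colourings n (2 * s + 1)"
  shows "n - n div (2 * s + 1 choose s) \<le> max_order f n s 1"
proof -
  let ?N = "2 * s + 1 choose s"
  interpret coloured_complete_graph "{1..n}" "{1..2 * s + 1}" "\<lambda>x y. f {x, y}" s
  proof
    fix x y assume "x \<in> {1..n}" "y \<in> {1..n}" "x \<noteq> y"
    then have "{x, y} \<in> all_edges {1..n}" unfolding all_edges_def by auto
    then show "f {x, y} \<in> {1..2 * s + 1}" using f unfolding colourings_def by blast
  qed (use s in \<open>auto simp: insert_commute\<close>)
  obtain A W where A: "A \<in> small_sets" and W: "W \<subseteq> {1..n}" "n - n div ?N \<le> card W"
    and uncut: "\<And>U. \<not> is_cut W A U"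
    using large_uncut_set by auto
  \<comment> \<open>A graph that is \<open>k_connected 1\<close> has at least two vertices;
    \<open>?N \<ge> 2 * s + 1 \<ge> 5\<close> makes \<open>W\<close> that large.\<close>
  have "n div ?N \<le> n div 5"
  proof (rule div_le_mono2)
    have "2 * s + 1 choose 1 \<le> ?N" using s by (intro binomial_mono) auto
    then show "5 \<le> ?N" using s by simp
  qed simp
  then have "2 \<le> card W" using W n by linarith
  define E where "E = {e \<in> all_edges W. f e \<in> A}"
  have "connected_graph W E"
  proof (rule connected_graph_if_uncut)
    show "W \<noteq> {}" using \<open>2 \<le> card W\<close> by auto
    fix U assume U: "U \<noteq> {}" "U \<subset> W"
    then obtain x y where xy: "x \<in> U" "y \<in> W - U" "f {x, y} \<in> A"
      using uncut[of U] unfolding is_cut_def by blast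
    moreover have "{x, y} \<in> all_edges W" using xy U unfolding all_edges_def by (auto simp: card_2_iff)
    ultimately show "\<exists>x\<in>U. \<exists>y\<in>W - U. {x, y} \<in> E" unfolding E_def by blast
  qed
  then have "k_connected 1 W E"
    using \<open>2 \<le> card W\<close> k_connected_1 W(1) finite_subset by blast
  moreover have "subgraph_complete n W E"
    using W(1) unfolding subgraph_complete_def E_def by auto
  moreover have "num_colours f E \<le> s"
  proof -
    have "finite A" "card A = s" using A finite_C finite_subset unfolding small_sets_def by auto
    moreover have "f ` E \<subseteq> A" unfolding E_def by auto
    ultimately show ?thesis unfolding num_colours_def using card_mono by blast
  qed
  ultimately have "card W \<le> max_order f n s 1"
    unfolding max_order_def using finite_subgraph_orders[of n 1 f s]
    by (intro Max_ge) auto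
  then show ?thesis using W(2) by simp
qed

section \<open>Upper bound: the partition colouring\<close>

lemma card_residue_class:
  fixes n N j :: nat
  assumes "j < N"
  shows "n div N \<le> card {i \<in> {1..n}. i mod N = j}"
proof -
  \<comment> \<open>The numbering starts at \<open>1\<close>, so the least representative of residue
    \<open>0\<close> is \<open>N\<close>.\<close>
  define r where "r = (if j = 0 then N else j)"
  have r: "1 \<le> r" "r \<le> N" "r mod N = j" using assms unfolding r_def by auto
  have "card {..<n div N} \<le> card {i \<in> {1..n}. i mod N = j}"
  proof (rule card_inj_on_le)
    show "inj_on (\<lambda>k. k * N + r) {..<n div N}" using assms by (auto intro: inj_onI)
    show "(\<lambda>k. k * N + r) ` {..<n div N} \<subseteq> {i \<in> {1..n}. i mod N = j}"
    proof (rule image_subsetI)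
      fix k assume "k \<in> {..<n div N}"
      then have "Suc k * N \<le> n div N * N" by (intro mult_le_mono1) auto
      also have "\<dots> \<le> n" by simp
      finally show "k * N + r \<in> {i \<in> {1..n}. i mod N = j}" using r by auto
    qed
  qed simp
  then show ?thesis by simp
qed

lemma max_order_upper:
  assumes s: "1 \<le> s"
  shows "\<exists>f\<in>colourings n (2 * s + 1). max_order f n s 1 \<le> n - n div (2 * s + 1 choose s)"
proof -
  let ?N = "2 * s + 1 choose s"
  let ?C = "{1..2 * s + 1}"
  let ?S = "{A. A \<subseteq> ?C \<and> card A = s}"
  have "card ?S = ?N" using n_subsets[of ?C s] by simp
  moreover have "finite ?S" by simp
  ultimately obtain h where h: "bij_betw h {0..<?N} ?S"
    using ex_bij_betw_nat_finite by metis
  have N: "0 < ?N" by simp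
  define part where "part i = h (i mod ?N)" for i
  have part: "part i \<subseteq> ?C" "card (part i) = s" for i
    using bij_betwE[OF h] N unfolding part_def by auto
  have avoid: "\<exists>c\<in>?C. \<forall>i\<in>e. c \<notin> part i" if e: "e \<in> all_edges {1..n}" for e
  proof -
    obtain x y where xy: "e = {x, y}" using e unfolding all_edges_def by (auto simp: card_2_iff)
    have "card (part x \<union> part y) \<le> 2 * s" using card_Un_le[of "part x" "part y"] part by simp
    then have "card (part x \<union> part y) < card ?C" by simp
    then have "\<not> ?C \<subseteq> part x \<union> part y"
      using part finite_subset[OF part(1)] by (metis card_mono finite_UnI not_le finite_atLeastAtMost)
    then show ?thesis using xy by blast
  qed
  \<comment> \<open>Restricting to the edges makes \<open>f\<close> extensional, as
    \<open>colourings\<close> demands.\<close>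
  define f where "f = (\<lambda>e\<in>all_edges {1..n}. SOME c. c \<in> ?C \<and> (\<forall>i\<in>e. c \<notin> part i))"
  have f: "f e \<in> ?C \<and> (\<forall>i\<in>e. f e \<notin> part i)" if e: "e \<in> all_edges {1..n}" for e
  proof -
    have "\<exists>c. c \<in> ?C \<and> (\<forall>i\<in>e. c \<notin> part i)" using avoid[OF e] by blast
    from someI_ex[OF this] show ?thesis using e unfolding f_def by simp
  qed
  have "f \<in> colourings n (2 * s + 1)"
    unfolding colourings_def using f by (auto simp: f_def)
  moreover have "max_order f n s 1 \<le> n - n div ?N"
  proof -
    have bound: "card V \<le> n - n div ?N"
      if G: "subgraph_complete n V E" "k_connected 1 V E" "num_colours f E \<le> s" for V E
    proof -
      have V: "V \<subseteq> {1..n}" "finite V" and E: "E \<subseteq> all_edges V"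
        using G(1) finite_subset unfolding subgraph_complete_def by auto
      have E': "E \<subseteq> all_edges {1..n}" using E V(1) unfolding all_edges_def by auto
      have "f ` E \<subseteq> ?C" using f E' by blast
      moreover have "card (f ` E) \<le> s" using G(3) unfolding num_colours_def .
      \<comment> \<open>The graph may use fewer than \<open>s\<close> colours; filling them up to
        exactly \<open>s\<close> singles out a part.\<close>
      ultimately obtain A where A: "f ` E \<subseteq> A" "A \<subseteq> ?C" "card A = s"
        using exists_subset_between[of "f ` E" s ?C] by auto
      then have "A \<in> h ` {0..<?N}" using h unfolding bij_betw_def by auto
      then obtain j where j: "j < ?N" "h j = A" by auto
      have conn: "2 \<le> card V" "connected_graph V E"
        using G(2) k_connected_1[OF V(2)] by auto
      \<comment> \<open>The first edge of a path from \<open>v\<close> to another vertex has a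
        colour in \<open>A\<close>, whereas edges at \<open>v\<close> avoid
        \<open>part v\<close>.\<close>
      have "part v \<noteq> A" if v: "v \<in> V" for v
      proof -
        have "\<not> V \<subseteq> {v}"
          using conn(1) card_mono[of "{v}" V] by auto
        then obtain u where u: "u \<in> V" "u \<noteq> v" by blast
        then have "(v, u) \<in> {(x, y). {x, y} \<in> E}\<^sup>*"
          using conn(2) v unfolding connected_graph_def by blast
        then obtain w where w: "{v, w} \<in> E" using u(2) by (auto elim: converse_rtranclE)
        then have "f {v, w} \<notin> part v" using f E' by blast
        then show ?thesis using A(1) w by blast
      qed
      then have "V \<subseteq> {1..n} - {i \<in> {1..n}. i mod ?N = j}"
        using V(1) j unfolding part_def by auto
      then have "card V \<le> card ({1..n} - {i \<in> {1..n}. i mod ?N = j})"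
        by (intro card_mono) auto
      also have "\<dots> = n - card {i \<in> {1..n}. i mod ?N = j}"
        by (subst card_Diff_subset) auto
      also have "\<dots> \<le> n - n div ?N" using card_residue_class[OF j(1)] by (intro diff_le_mono2)
      finally show ?thesis .
    qed
    show ?thesis
      unfolding max_order_def using finite_subgraph_orders[of n 1 f s] bound
      by (intro Max.boundedI) auto
  qed
  ultimately show ?thesis by blast
qed

section \<open>The exact value\<close>

lemma finite_colourings: "finite (colourings n r)"
proof -
  have "finite (all_edges {1..n})"
    by (rule finite_subset[of _ "Pow {1..n}"]) (auto simp: all_edges_def)
  then show ?thesis unfolding colourings_def by (intro finite_PiE) auto
qed

lemma min_max_order_eq:
  assumes "2 \<le> n" "2 \<le> s"
  shows "min_max_order n (2 * s + 1) s 1 = n - n div (2 * s + 1 choose s)"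
proof -
  obtain f where f: "f \<in> colourings n (2 * s + 1)"
    "max_order f n s 1 \<le> n - n div (2 * s + 1 choose s)"
    using max_order_upper[of s n] assms by auto
  then have "max_order f n s 1 = n - n div (2 * s + 1 choose s)"
    using max_order_lower assms by (intro antisym) auto
  then have "n - n div (2 * s + 1 choose s)
      \<in> (\<lambda>f. max_order f n s 1) ` colourings n (2 * s + 1)"
    using f(1) by (metis image_eqI)
  then show ?thesis
    unfolding min_max_order_def using max_order_lower[OF assms] finite_colourings
    by (intro Min_eqI) auto
qed

theorem theorem4p6:
  fixes n s :: nat
  assumes "n \<ge> 2" and "s \<ge> 2"
  shows "int (min_max_order n (2 * s + 1) s 1) =
           \<lceil>(1 - inverse (real ((2 * s + 1) choose s))) * real n\<rceil>"
proof -
  let ?N = "2 * s + 1 choose s"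
  have "(1 - inverse (real ?N)) * real n = of_int (int n) - real n / real ?N"
    by (simp add: field_simps)
  then have "\<lceil>(1 - inverse (real ?N)) * real n\<rceil> = int n - \<lfloor>real n / real ?N\<rfloor>"
    by linarith
  also have "\<dots> = int n - int (n div ?N)" by (simp add: floor_divide_of_nat_eq)
  also have "\<dots> = int (n - n div ?N)" by (simp add: of_nat_diff)
  finally show ?thesis using min_max_order_eq[OF assms] by simp
qed

end
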